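(* Let $k\ge 1$ and let $G$ be a $k$-path with associated sequence $e_0,t_1,e_1,t_2,\dots,t_p,e_p$ of $k$-cliques $e_i$ and $(k+1)$-cliques $t_i$. Then $e_0$ is a zero forcing set for $G$, and the forces in which the single vertex of $t_i\setminus e_i$ forces the single vertex of $t_i\setminus e_{i-1}$, performed in the order $i=1,2,\dots,p$, are valid and produce a set of zero forcing chains for $G$ starting from $e_0$. Consequently $Z(G)=M(G)=k$.
   Context: All graphs are simple and undirected. A $k$-path is a graph $G$ built together with a sequence $e_0,t_1,e_1,\dots,t_p,e_p$ ($p\ge1$) as follows: $t_1$ is a complete graph $K_{k+1}$ and $e_0,e_1$ are two distinct $k$-element subsets of $t_1$; for $i=2,\dots,p$ a new vertex $u_i$ is added adjacent exactly to the vertices of $e_{i-1}$, $t_i=e_{i-1}\cup\{u_i\}$, and $e_i$ is a $k$-element subset of $t_i$ different from $e_{i-1}$ (when $i=p$, $e_p$ is any $k$-subset of $t_p$ other than $e_{p-1}$). Thus $e_{i-1},e_i\subseteq t_i$, each $t_i$ is a $(k+1)$-clique, each $e_i$ is a $k$-clique, and $t_i\setminus e_i$ and $t_i\setminus e_{i-1}$ are single vertices. For a graph $G$ on $n$ vertices, $S(G)$ is the set of real symmetric $n\times n$ matrices whose off-diagonal entry $(i,j)$ is nonzero iff $ij\in E(G)$ (diagonal unrestricted); $M(G)=\max\{\operatorname{nullity}A:A\in S(G)\}$. Zero forcing: with vertices colored blue/white, a blue vertex $b$ with exactly one white neighbor $w$ may force $w$ blue (written $b\to w$); a zero forcing set is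 an initial blue set from which all vertices become blue; $Z(G)$ is the minimum size of such a set. Given a zero forcing set $B$ and a chronological list of valid forces, the zero forcing chain of $v\in B$ is the sequence $v=v_0,v_1,\dots,v_m$ with $v_{j-1}\to v_j$ in the list. *)

theory Defs
  imports "HOL-Analysis.Analysis" "Graph_Theory.Pair_Digraph"
begin

text \<open>
  Finite simple undirected graphs are those of the locale \<^locale>\<open>pair_graph\<close>: an edge is a
  pair of opposite arcs.  The sequences \<open>e\<close> and \<open>t\<close> are functions on the natural numbers of which
  only \<open>e 0, \<dots>, e p\<close> and \<open>t 1, \<dots>, t p\<close> matter.
\<close>

inductive k_path ::
  "nat \<Rightarrow> (nat \<Rightarrow> 'v set) \<Rightarrow> (nat \<Rightarrow> 'v set) \<Rightarrow> nat \<Rightarrow> 'v pair_pre_digraph \<Rightarrow> bool"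
  for k e t
where
  first: "card (t 1) = k + 1 \<Longrightarrow>
    e 0 \<subseteq> t 1 \<Longrightarrow> card (e 0) = k \<Longrightarrow> e 1 \<subseteq> t 1 \<Longrightarrow> card (e 1) = k \<Longrightarrow> e 0 \<noteq> e 1 \<Longrightarrow>
    k_path k e t 1 \<lparr>pverts = t 1, parcs = {(x, y). x \<in> t 1 \<and> y \<in> t 1 \<and> x \<noteq> y}\<rparr>"
| step: "k_path k e t p G \<Longrightarrow> u \<notin> pverts G \<Longrightarrow> t (Suc p) = insert u (e p) \<Longrightarrow>
    e (Suc p) \<subseteq> t (Suc p) \<Longrightarrow> card (e (Suc p)) = k \<Longrightarrow> e (Suc p) \<noteq> e p \<Longrightarrow>
    k_path k e t (Suc p)
      \<lparr>pverts = insert u (pverts G), parcs = parcs G \<union> {u} \<times> e p \<union> e p \<times> {u}\<rparr>"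

lemma k_path_clique_subset: "k_path k e t p G \<Longrightarrow> e p \<subseteq> t p \<and> t p \<subseteq> pverts G"
  by (induction rule: k_path.induct) auto

lemma k_path_pair_graph: "k_path k e t p G \<Longrightarrow> pair_graph G"
proof (induction rule: k_path.induct)
  case first
  then have "finite (t 1)" by (auto intro: card_ge_0_finite)
  moreover from this have "finite {(x, y). x \<in> t 1 \<and> y \<in> t 1 \<and> x \<noteq> y}"
    by (auto intro: finite_subset[of _ "t 1 \<times> t 1"])
  ultimately show ?case
    by unfold_locales (auto simp: symmetric_def sym_def)
next
  case (step p G u)
  interpret G: pair_graph G by fact
  have sub: "e p \<subseteq> pverts G" using k_path_clique_subset step(1) by blast
  then have fin: "finite (e p)" using G.pair_finite_verts by (rule finite_subset)
  have s: "sym (parcs G)"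
    using G.pair_sym_arcs by (simp add: symmetric_def)
  have loop: "(x, x) \<notin> parcs G" for x using G.pair_no_loops by fastforce
  show ?case
    using sub fin step(2) s loop G.pair_finite_arcs G.pair_finite_verts
    by unfold_locales (auto simp: symmetric_def sym_def dest: G.in_arcsD1 G.in_arcsD2)
qed

definition can_force :: "'v pair_pre_digraph \<Rightarrow> 'v set \<Rightarrow> 'v \<Rightarrow> 'v \<Rightarrow> bool" where
  "can_force G C b w \<longleftrightarrow> b \<in> C \<and> {x \<in> pverts G - C. (b, x) \<in> parcs G} = {w}"

text \<open>The list is chronological: its head is performed first, \<open>C\<close> is the current blue set.\<close>

fun valid_forces :: "'v pair_pre_digraph \<Rightarrow> 'v set \<Rightarrow> ('v \<times> 'v) list \<Rightarrow> bool" where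
  "valid_forces G C [] \<longleftrightarrow> True"
| "valid_forces G C ((b, w) # fs) \<longleftrightarrow> can_force G C b w \<and> valid_forces G (insert w C) fs"

definition blue_after :: "'v set \<Rightarrow> ('v \<times> 'v) list \<Rightarrow> 'v set" where
  "blue_after B fs = B \<union> snd ` set fs"

definition zero_forcing_set :: "'v pair_pre_digraph \<Rightarrow> 'v set \<Rightarrow> bool" where
  "zero_forcing_set G B \<longleftrightarrow>
    B \<subseteq> pverts G \<and> (\<exists>fs. valid_forces G B fs \<and> blue_after B fs = pverts G)"

definition zero_forcing_number :: "'v pair_pre_digraph \<Rightarrow> nat" where
  "zero_forcing_number G = Min (card ` {B. zero_forcing_set G B})"

text \<open>Chains are maximal: the last vertex performs no force.  A vertex that never forces has
  the one-element chain.\<close>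

definition zero_forcing_chain :: "('v \<times> 'v) list \<Rightarrow> 'v \<Rightarrow> 'v list \<Rightarrow> bool" where
  "zero_forcing_chain fs v vs \<longleftrightarrow> vs \<noteq> [] \<and> hd vs = v \<and>
    successively (\<lambda>x y. (x, y) \<in> set fs) vs \<and> last vs \<notin> fst ` set fs"

text \<open>The chains partition the vertices, one chain starting at each vertex of \<open>B\<close>.\<close>

definition produces_zero_forcing_chains ::
  "'v pair_pre_digraph \<Rightarrow> 'v set \<Rightarrow> ('v \<times> 'v) list \<Rightarrow> bool" where
  "produces_zero_forcing_chains G B fs \<longleftrightarrow>
    valid_forces G B fs \<and> blue_after B fs = pverts G \<and>
    (\<forall>v\<in>B. \<exists>!vs. zero_forcing_chain fs v vs) \<and>
    (\<forall>x\<in>pverts G. \<exists>!vs. (\<exists>v\<in>B. zero_forcing_chain fs v vs) \<and> x \<in> set vs)"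

text \<open>Rows and columns are indexed by the vertex type itself, so the next definitions are meant
  for graphs with \<open>pverts G = UNIV\<close>, where \<open>n = CARD('v)\<close>.\<close>

definition sym_matrices :: "('v::finite) pair_pre_digraph \<Rightarrow> (real ^ 'v ^ 'v) set" where
  "sym_matrices G = {A. transpose A = A \<and> (\<forall>i j. i \<noteq> j \<longrightarrow> (A $ i $ j \<noteq> 0 \<longleftrightarrow> (i, j) \<in> parcs G))}"

definition nullity :: "real ^ 'n ^ 'm \<Rightarrow> nat" where
  "nullity A = dim {x. A *v x = 0}"

definition max_nullity :: "('v::finite) pair_pre_digraph \<Rightarrow> nat" where
  "max_nullity G = Max (nullity ` sym_matrices G)"

end

theory Submission
  imports Defs
begin

text \<open>
  Once a vertex leaves the cliques \<open>e i\<close> it never returns, so all neighbours of the vertex of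
  \<open>t i - e i\<close> lie in \<open>t 1 \<union> \<dots> \<union> t i\<close>, and its only white neighbour at time \<open>i\<close> is the new vertex.
  A kernel vector of a matrix in \<open>S(G)\<close> that vanishes on a zero forcing set is zero, whence
  \<open>M(G) \<le> Z(G) \<le> k\<close>.  Conversely the sum of the matrices \<open>1 1\<^sup>T\<close> over the indicator vectors \<open>1\<close>
  of \<open>t 1, \<dots>, t p\<close> lies in \<open>S(G)\<close> and has rank at most \<open>p = n - k\<close>, so \<open>k \<le> M(G)\<close>.
\<close>

section \<open>Zero forcing chains\<close>

lemma blue_after_Nil [simp]: "blue_after C [] = C"
  by (simp add: blue_after_def)

lemma blue_after_Cons [simp]: "blue_after C ((b, w) # fs) = blue_after (insert w C) fs"
  by (auto simp: blue_after_def)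

lemma valid_forces_append:
  "valid_forces G C (fs @ gs) \<longleftrightarrow> valid_forces G C fs \<and> valid_forces G (blue_after C fs) gs"
  by (induction fs arbitrary: C) auto

lemma valid_forces_source_blue:
  "valid_forces G C fs \<Longrightarrow> fst ` set fs \<subseteq> blue_after C fs"
proof (induction fs arbitrary: C)
  case (Cons f fs)
  then show ?case
    by (cases f) (auto simp: can_force_def blue_after_def)
qed simp

text \<open>A force uses up the only white neighbour of its source, and blue vertices stay blue.
  Hence no vertex forces twice, which keeps chains from branching.\<close>

lemma valid_forces_source_exhausted:
  assumes "valid_forces G C fs" "b \<in> fst ` set fs"
  shows "{x \<in> pverts G - blue_after C fs. (b, x) \<in> parcs G} = {}"
  using assms
proof (induction fs arbitrary: C)
  case (Cons f fs)
  obtain c w where f: "f = (c, w)" by (cases f)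
  show ?case
  proof (cases "b \<in> fst ` set fs")
    case True
    then show ?thesis using Cons f by auto
  next
    case False
    then have "{x \<in> pverts G - C. (b, x) \<in> parcs G} = {w}"
      using Cons.prems f by (auto simp: can_force_def)
    then show ?thesis using f by (auto simp: blue_after_def)
  qed
qed simp

text \<open>Every entry of a chain before the last is the source of a force.\<close>

lemma zero_forcing_chain_last:
  assumes "zero_forcing_chain fs v vs" "b \<in> set vs" "b \<notin> fst ` set fs"
  shows "last vs = b"
proof -
  have "successively (\<lambda>x y. (x, y) \<in> set fs) vs \<Longrightarrow> last vs = b"
    using assms(2)
  proof (induction vs)
    case (Cons a vs)
    then show ?case using assms(3)
      by (cases vs) (force simp: image_iff)+
  qed simp
  then show ?thesis using assms(1) by (simp add: zero_forcing_chain_def)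
qed

lemma successively_set_subset:
  "successively (\<lambda>x y. (x, y) \<in> R) vs \<Longrightarrow> set vs \<subseteq> insert (hd vs) (snd ` R)"
proof (induction vs)
  case (Cons a vs)
  then show ?case by (cases vs) (force simp: image_iff)+
qed simp

lemma successively_insert_unreached:
  assumes "successively (\<lambda>x y. (x, y) \<in> insert (b, w) R) vs" "w \<notin> set vs"
  shows "successively (\<lambda>x y. (x, y) \<in> R) vs"
  using assms by (induction vs rule: induct_list012) auto

text \<open>Before the new force, \<open>b\<close> can only end a chain and \<open>w\<close> takes
  part in no force, so the only effect is to append \<open>w\<close> to a chain ending in
  \<open>b\<close>. The condition \<open>v \<noteq> w\<close> excludes the chain that starts at
  \<open>w\<close> itself.\<close>

lemma zero_forcing_chain_snoc_iff:
  assumes b: "b \<notin> fst ` set fs" and w: "w \<notin> fst ` set fs" "w \<noteq> b" "w \<notin> snd ` set fs" and v: "v \<noteq> w"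
  shows "zero_forcing_chain (fs @ [(b, w)]) v us \<longleftrightarrow>
    (\<exists>vs. zero_forcing_chain fs v vs \<and> us = (if last vs = b then vs @ [w] else vs))"
    (is "?L \<longleftrightarrow> ?R")
proof
  assume L: ?L
  then have us: "us \<noteq> []" "hd us = v" "last us \<notin> fst ` set fs" "last us \<noteq> b"
    and suc: "successively (\<lambda>x y. (x, y) \<in> insert (b, w) (set fs)) us"
    by (auto simp: zero_forcing_chain_def)
  show ?R
  proof (cases "w \<in> set us")
    case False
    then have "zero_forcing_chain fs v us"
      using us successively_insert_unreached[OF suc] by (simp add: zero_forcing_chain_def)
    then show ?thesis using us by auto
  next
    case True
    have "last us = w"
      using zero_forcing_chain_last[OF L True] w by auto
    then obtain vs where us_eq: "us = vs @ [w]"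
      using us(1) by (metis append_butlast_last_id)
    have ne: "vs \<noteq> []" using us(2) us_eq v by auto
    have suc': "successively (\<lambda>x y. (x, y) \<in> insert (b, w) (set fs)) vs"
      and "(last vs, w) \<in> insert (b, w) (set fs)"
      using suc us_eq ne by (auto simp: successively_append_iff)
    then have last: "last vs = b" using w by force
    \<comment> \<open>Every entry of \<open>us\<close> before the last one is a source, whereas
      \<open>w\<close> forces nothing.\<close>
    have "w \<notin> set vs"
    proof
      assume "w \<in> set vs"
      moreover have "y = w \<longrightarrow> False" if "y \<in> set (butlast us)" for y
      proof -
        have "y \<in> fst ` insert (b, w) (set fs)"
          using suc that
        proof (induction us)
          case (Cons a us)
          then show ?case by (cases us) (force simp: image_iff split: if_splits)+
        qed simp
        then show ?thesis using w by auto
      qed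
      ultimately show False using us_eq by auto
    qed
    then have "zero_forcing_chain fs v vs"
      using successively_insert_unreached[OF suc'] ne us(2) us_eq last b
      by (simp add: zero_forcing_chain_def)
    then show ?thesis using last us_eq by auto
  qed
next
  assume ?R
  then obtain vs where vs: "zero_forcing_chain fs v vs"
    and us: "us = (if last vs = b then vs @ [w] else vs)" by blast
  have "successively (\<lambda>x y. (x, y) \<in> set (fs @ [(b, w)])) vs"
    using vs by (auto simp: zero_forcing_chain_def elim: successively_mono)
  then show ?L
    using vs us w by (auto simp: zero_forcing_chain_def successively_append_iff)
qed

text \<open>Induction on the last force: it lengthens a chain at its end and so keeps existence and
  uniqueness. Stating the partition for the current blue set instead of all vertices lets the
  induction run through incomplete lists.\<close>

lemma valid_forces_chains:
  assumes "valid_forces G B fs"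
  shows "(\<forall>v\<in>B. \<exists>!vs. zero_forcing_chain fs v vs) \<and>
    (\<forall>x\<in>blue_after B fs. \<exists>!vs. (\<exists>v\<in>B. zero_forcing_chain fs v vs) \<and> x \<in> set vs)"
  using assms
proof (induction fs rule: rev_induct)
  case Nil
  have "zero_forcing_chain [] v vs \<longleftrightarrow> vs = [v]" for v :: 'a and vs
    unfolding zero_forcing_chain_def by (cases vs; cases "tl vs") auto
  then show ?case by auto
next
  case (snoc f fs)
  obtain b w where f: "f = (b, w)" by (cases f)
  have val: "valid_forces G B fs" and force: "can_force G (blue_after B fs) b w"
    using snoc.prems f by (auto simp: valid_forces_append)
  have w: "w \<notin> blue_after B fs" "b \<in> blue_after B fs"
    using force by (auto simp: can_force_def)
  have b: "b \<notin> fst ` set fs"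
    using valid_forces_source_exhausted[OF val] force by (auto simp: can_force_def)
  have w': "w \<notin> fst ` set fs" "w \<noteq> b" "w \<notin> snd ` set fs" "w \<notin> B"
    using w valid_forces_source_blue[OF val] by (auto simp: blue_after_def)
  \<comment> \<open>\<open>ext\<close> carries the chains of \<open>fs\<close> to those of
    \<open>fs @ [f]\<close>.\<close>
  define ext where "ext vs = (if last vs = b then vs @ [w] else vs)" for vs
  have iff: "zero_forcing_chain (fs @ [f]) v us \<longleftrightarrow>
      (\<exists>vs. zero_forcing_chain fs v vs \<and> us = ext vs)" if "v \<in> B" for v us
    unfolding f ext_def by (rule zero_forcing_chain_snoc_iff) (use b w' that in auto)
  have IH1: "\<exists>!vs. zero_forcing_chain fs v vs" if "v \<in> B" for v
    using snoc.IH[OF val] that by blast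
  have IH2: "\<exists>!vs. (\<exists>v\<in>B. zero_forcing_chain fs v vs) \<and> x \<in> set vs" if "x \<in> blue_after B fs" for x
    using snoc.IH[OF val] that by blast
  have w_unreached: "w \<notin> set vs" if "zero_forcing_chain fs v vs" "v \<in> B" for v vs
    using successively_set_subset[of "set fs" vs] that w' by (auto simp: zero_forcing_chain_def)
  have "\<exists>!vs. zero_forcing_chain (fs @ [f]) v vs" if "v \<in> B" for v
    using IH1[OF that] iff[OF that] by metis
  moreover have "\<exists>!us. (\<exists>v\<in>B. zero_forcing_chain (fs @ [f]) v us) \<and> x \<in> set us"
    if x: "x \<in> blue_after B (fs @ [f])" for x
  proof -
    \<comment> \<open>An extended chain contains \<open>w\<close> exactly if the old one contained
      \<open>b\<close>, so the chain through \<open>w\<close> is found as the one through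
      \<open>b\<close>.\<close>
    define y where "y = (if x = w then b else x)"
    have "y \<in> blue_after B fs"
      using x w f by (auto simp: y_def blue_after_def)
    moreover have "x \<in> set (ext vs) \<longleftrightarrow> y \<in> set vs" if "zero_forcing_chain fs v vs" "v \<in> B" for v vs
      using w_unreached[OF that] zero_forcing_chain_last[OF that(1) _ b] that(1)
      by (auto simp: ext_def y_def zero_forcing_chain_def)
    ultimately show ?thesis using IH2[of y] iff by metis
  qed
  ultimately show ?case by blast
qed

section \<open>Zero forcing sets bound the nullity\<close>

text \<open>When \<open>b\<close> forces \<open>w\<close>, row \<open>b\<close> of
  \<open>A *v x = 0\<close> collapses to one term, the product of the nonzero entry at
  \<open>(b, w)\<close> with \<open>x $ w\<close>.\<close>

lemma zero_forcing_kernel_vanishes: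
  fixes G :: "('v::finite) pair_pre_digraph"
  assumes A: "A \<in> sym_matrices G" and ker: "A *v x = 0" and UNIV: "pverts G = UNIV"
    and "valid_forces G C fs" "\<forall>i\<in>C. x $ i = 0"
  shows "\<forall>i\<in>blue_after C fs. x $ i = 0"
  using assms(4,5)
proof (induction fs arbitrary: C)
  case (Cons f fs)
  obtain b w where f: "f = (b, w)" by (cases f)
  have bC: "b \<in> C" and nbrs: "{y. y \<notin> C \<and> (b, y) \<in> parcs G} = {w}"
    using Cons.prems f UNIV by (auto simp: can_force_def)
  have sym: "A $ b $ j \<noteq> 0 \<longleftrightarrow> (b, j) \<in> parcs G" if "b \<noteq> j" for j
    using A that by (auto simp: sym_matrices_def)
  have "0 = (A *v x) $ b" using ker by simp
  also have "\<dots> = (\<Sum>j\<in>UNIV. A $ b $ j * x $ j)"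
    by (simp add: matrix_vector_mult_def)
  also have "\<dots> = (\<Sum>j\<in>{w}. A $ b $ j * x $ j)"
  proof (rule sum.mono_neutral_right)
    \<comment> \<open>A blue \<open>j\<close> has \<open>x $ j = 0\<close>, and a white
      non-neighbour has a zero matrix entry. The unrestricted diagonal entry does no harm because
      \<open>b\<close> is blue.\<close>
    show "\<forall>j\<in>UNIV - {w}. A $ b $ j * x $ j = 0"
    proof
      fix j assume "j \<in> UNIV - {w}"
      then have "j \<in> C \<or> (b, j) \<notin> parcs G" using nbrs by blast
      then show "A $ b $ j * x $ j = 0"
        using Cons.prems(2) bC sym[of j] by (cases "b = j") auto
    qed
  qed auto
  finally have "A $ b $ w * x $ w = 0" by simp
  moreover have "A $ b $ w \<noteq> 0"
    using nbrs bC sym[of w] by blast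
  ultimately have "\<forall>i\<in>insert w C. x $ i = 0"
    using Cons.prems(2) by simp
  moreover have "valid_forces G (insert w C) fs" using Cons.prems(1) f by simp
  ultimately show ?case using Cons.IH f by (metis blue_after_Cons)
qed simp

lemma subspace_kernel_matrix:
  fixes A :: "real ^ 'n ^ 'm"
  shows "subspace {x. A *v x = 0}"
  by (rule subspaceI) (auto simp: matrix_vector_right_distrib matrix_vector_mult_scaleR)

text \<open>The kernel meets the space of vectors vanishing on \<open>B\<close> only in zero. That
  space has codimension \<open>card B\<close>, so a dimension count bounds the kernel.\<close>

lemma nullity_le_zero_forcing:
  fixes G :: "('v::finite) pair_pre_digraph"
  assumes A: "A \<in> sym_matrices G" and UNIV: "pverts G = UNIV" and B: "zero_forcing_set G B"
  shows "nullity A \<le> card B"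
proof -
  let ?K = "{x. A *v x = 0}"
  \<comment> \<open>The vectors vanishing on \<open>B\<close>, written with the complement
    \<open>- B\<close> to match \<open>dim_substandard_cart\<close>.\<close>
  let ?T = "{x :: real ^ 'v. \<forall>i. i \<notin> - B \<longrightarrow> x $ i = 0}"
  obtain fs where fs: "valid_forces G B fs" "blue_after B fs = UNIV"
    using B UNIV by (auto simp: zero_forcing_set_def)
  have "?K \<inter> ?T \<subseteq> {0}"
  proof
    fix x assume "x \<in> ?K \<inter> ?T"
    then have "\<forall>i\<in>UNIV. x $ i = 0"
      using zero_forcing_kernel_vanishes[OF A _ UNIV fs(1), of x] fs(2) by simp
    then show "x \<in> {0}" by (simp add: vec_eq_iff)
  qed
  then have "dim (?K \<inter> ?T) = 0" by simp
  moreover have "subspace ?T" by (rule subspaceI) auto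
  then have "dim {x + y |x y. x \<in> ?K \<and> y \<in> ?T} + dim (?K \<inter> ?T) = dim ?K + dim ?T"
    using subspace_kernel_matrix by (intro dim_sums_Int) auto
  moreover have "dim {x + y |x y. x \<in> ?K \<and> y \<in> ?T} \<le> CARD('v)"
    by (rule order.trans[OF dim_subset_UNIV_cart]) simp
  moreover have "dim ?T = card (- B)"
    by (simp only: dim_substandard_cart flip: dim_vec_eq)
  moreover have "card (- B) + card B = CARD('v)"
    by (simp add: Compl_eq_Diff_UNIV card_Diff_subset card_mono)
  ultimately show ?thesis unfolding nullity_def by linarith
qed

lemma nullity_le_CARD: "nullity (A :: real ^ 'n ^ 'm) \<le> CARD('n)"
  unfolding nullity_def by (rule dim_subset_UNIV_cart)

lemma zero_forcing_number_eqI: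
  fixes G :: "('v::finite) pair_pre_digraph"
  assumes "zero_forcing_set G B" "\<And>C. zero_forcing_set G C \<Longrightarrow> card B \<le> card C"
  shows "zero_forcing_number G = card B"
  unfolding zero_forcing_number_def using assms by (intro Min_eqI) auto

text \<open>Although \<open>sym_matrices G\<close> is infinite, nullities are bounded by the number
  of columns, so \<open>Max\<close> ranges over a finite set.\<close>

lemma max_nullity_eqI:
  assumes "A \<in> sym_matrices G" "\<And>C. C \<in> sym_matrices G \<Longrightarrow> nullity C \<le> nullity A"
  shows "max_nullity G = nullity A"
  unfolding max_nullity_def
proof (rule Max_eqI)
  show "finite (nullity ` sym_matrices G)"
    by (rule finite_subset[of _ "{..CARD('a)}"]) (use nullity_le_CARD in auto)
qed (use assms in auto)

text \<open>A sum of \<open>card I\<close> matrices of rank at most one annihilates the orthogonal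
  complement of the span of the \<open>u i\<close>. The additive form avoids truncated
  subtraction.\<close>

lemma nullity_sum_outer_ge:
  fixes u :: "'i \<Rightarrow> real ^ 'v"
  assumes "finite I"
  shows "CARD('v) \<le> nullity (\<chi> x y. \<Sum>i\<in>I. u i $ x * u i $ y) + card I"
proof -
  let ?S = "span (u ` I)"
  let ?A = "\<chi> x y. \<Sum>i\<in>I. u i $ x * u i $ y"
  have "{y \<in> UNIV. \<forall>x\<in>?S. orthogonal x y} \<subseteq> {x. ?A *v x = 0}"
  proof
    fix y assume "y \<in> {y \<in> UNIV. \<forall>x\<in>?S. orthogonal x y}"
    then have orth: "u i \<bullet> y = 0" if "i \<in> I" for i
      using that by (auto simp: orthogonal_def intro: span_base)
    have "(?A *v y) $ x = (\<Sum>i\<in>I. u i $ x * (u i \<bullet> y))" for x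
      by (simp add: matrix_vector_mult_def inner_vec_def sum_distrib_left sum_distrib_right
          sum.swap[of _ UNIV] mult.assoc)
    then show "y \<in> {x. ?A *v x = 0}" using orth by (simp add: vec_eq_iff)
  qed
  then have "dim {y \<in> UNIV. \<forall>x\<in>?S. orthogonal x y} \<le> nullity ?A"
    unfolding nullity_def by (rule dim_subset)
  moreover have "dim {y \<in> UNIV. \<forall>x\<in>?S. orthogonal x y} + dim ?S = dim (UNIV :: (real ^ 'v) set)"
    by (rule dim_subspace_orthogonal_to_vectors) (auto simp: subspace_UNIV)
  moreover have "dim ?S \<le> card I"
    using assms by (intro order.trans[OF dim_le_card card_image_le]) auto
  ultimately show ?thesis by simp
qed

section \<open>The structure of a \<open>k\<close>-path\<close>

lemma k_path_finite_verts:
  assumes "k_path k e t p G"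
  shows "finite (pverts G)"
proof -
  interpret pair_graph G using assms by (rule k_path_pair_graph)
  show ?thesis by (rule pair_finite_verts)
qed

lemma k_path_cliques:
  assumes "k_path k e t p G"
  shows "\<forall>i\<in>{1..p}. card (t i) = k + 1 \<and> e (i - 1) \<subseteq> t i \<and> card (e (i - 1)) = k \<and>
    e i \<subseteq> t i \<and> card (e i) = k \<and> e i \<noteq> e (i - 1)"
  using assms
proof (induction rule: k_path.induct)
  case (step p G u)
  have sub: "e p \<subseteq> t p" "t p \<subseteq> pverts G" "finite (pverts G)"
    using k_path_clique_subset[OF step(1)] k_path_finite_verts[OF step(1)] by auto
  have "p \<ge> 1" using step(1) by (induction rule: k_path.induct) auto
  then have "card (e p) = k" using step.IH by auto
  moreover have "finite (e p)" "u \<notin> e p"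
    using sub step(2) by (auto intro: finite_subset)
  ultimately have "card (t (Suc p)) = k + 1" "e p \<subseteq> t (Suc p)"
    by (auto simp: step(3))
  then show ?case
    using step.IH step(4-6) \<open>card (e p) = k\<close> by (simp add: atLeastAtMostSuc_conv)
qed auto

lemma k_path_pos: "k_path k e t p G \<Longrightarrow> p \<ge> 1"
  by (induction rule: k_path.induct) auto

lemma k_path_verts:
  assumes "k_path k e t p G"
  shows "pverts G = (\<Union>i\<in>{1..p}. t i)"
  using assms
proof (induction rule: k_path.induct)
  case (step p G u)
  then show ?case
    using k_path_clique_subset[OF step(1)] by (auto simp: atLeastAtMostSuc_conv)
qed auto

text \<open>The new clique consists of \<open>u\<close> and \<open>e p\<close>. Its pairs inside
  \<open>e p\<close> are edges already, since \<open>e p\<close> lies in \<open>t p\<close>, so only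
  the pairs with \<open>u\<close> are added.\<close>

lemma k_path_arcs:
  assumes "k_path k e t p G"
  shows "(x, y) \<in> parcs G \<longleftrightarrow> x \<noteq> y \<and> (\<exists>i\<in>{1..p}. x \<in> t i \<and> y \<in> t i)"
  using assms
proof (induction rule: k_path.induct)
  case (step p G u)
  have ep: "e p \<subseteq> t p" "u \<notin> e p" and p: "p \<in> {1..p}"
    using k_path_clique_subset[OF step(1)] k_path_pos[OF step(1)] step(2) by auto
  have "(\<exists>i\<in>{1..Suc p}. x \<in> t i \<and> y \<in> t i) \<longleftrightarrow>
      (\<exists>i\<in>{1..p}. x \<in> t i \<and> y \<in> t i) \<or> x \<in> insert u (e p) \<and> y \<in> insert u (e p)"
    by (simp add: atLeastAtMostSuc_conv step(3) disj_commute)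
  also have "\<dots> \<longleftrightarrow> (\<exists>i\<in>{1..p}. x \<in> t i \<and> y \<in> t i) \<or>
      (x, y) \<in> {u} \<times> e p \<union> e p \<times> {u} \<or> x = u \<and> y = u"
    using ep p by blast
  finally show ?case
    using step.IH ep(2) by auto
qed auto

text \<open>Each added vertex is new to the graph built so far. The term \<open>e 0\<close> covers
  \<open>i = 1\<close>, where the union over \<open>{1..<i}\<close> is empty.\<close>

lemma k_path_fresh:
  assumes "k_path k e t p G"
  shows "\<forall>i\<in>{1..p}. (t i - e (i - 1)) \<inter> (e 0 \<union> (\<Union>j\<in>{1..<i}. t j)) = {}"
  using assms
proof (induction rule: k_path.induct)
  case (step p G u)
  have one: "1 \<in> {1..p}" using k_path_pos[OF step(1)] by simp
  then have "e 0 \<subseteq> t 1" using bspec[OF k_path_cliques[OF step(1)] one] by simp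
  then have "e 0 \<union> (\<Union>j\<in>{1..<Suc p}. t j) \<subseteq> pverts G"
    using k_path_verts[OF step(1)] one by (auto simp: atLeastLessThanSuc_atLeastAtMost)
  then have "(t (Suc p) - e p) \<inter> (e 0 \<union> (\<Union>j\<in>{1..<Suc p}. t j)) = {}"
    using step(2) unfolding step(3) by auto
  then show ?case
    using step.IH by (simp add: atLeastAtMostSuc_conv)
qed auto

section \<open>Forcing along the clique sequence\<close>

locale k_path_sequence =
  fixes k :: nat and e t :: "nat \<Rightarrow> 'v set" and p :: nat and G :: "'v pair_pre_digraph"
  assumes k_path: "k_path k e t p G"
begin

text \<open>The value of \<open>the_elem\<close> is meaningful only for \<open>i\<close> in
  \<open>{1..p}\<close>, where \<open>singletons\<close> shows the difference to have one element.
  The same holds for \<open>target\<close>.\<close>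

definition source :: "nat \<Rightarrow> 'v" where
  "source i = the_elem (t i - e i)"

definition target :: "nat \<Rightarrow> 'v" where
  "target i = the_elem (t i - e (i - 1))"

definition forces :: "nat \<Rightarrow> ('v \<times> 'v) list" where
  "forces i = map (\<lambda>i. (source i, target i)) [1..<i + 1]"

lemma e_subset: "i \<in> {1..p} \<Longrightarrow> e i \<subseteq> t i" "i \<in> {1..p} \<Longrightarrow> e (i - 1) \<subseteq> t i"
  using bspec[OF k_path_cliques[OF k_path]] by simp_all

lemma card_e0: "card (e 0) = k"
  using bspec[OF k_path_cliques[OF k_path], of 1] k_path_pos[OF k_path] by simp

lemma finite_t: "i \<in> {1..p} \<Longrightarrow> finite (t i)"
  using bspec[OF k_path_cliques[OF k_path]] by (intro card_ge_0_finite) simp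

lemma singletons:
  assumes "i \<in> {1..p}"
  shows "t i - e i = {source i}" "t i - e (i - 1) = {target i}"
proof -
  have "finite (e i)" "finite (e (i - 1))"
    using e_subset[OF assms] finite_t[OF assms] by (simp_all add: finite_subset[of _ "t i"])
  then have "card (t i - e i) = 1" "card (t i - e (i - 1)) = 1"
    using bspec[OF k_path_cliques[OF k_path] assms] by (simp_all add: card_Diff_subset)
  then show "t i - e i = {source i}" "t i - e (i - 1) = {target i}"
    by (auto simp: source_def target_def card_1_singleton_iff)
qed

text \<open>Otherwise source and target would coincide, contradicting
  \<open>e i \<noteq> e (i - 1)\<close>. This makes the source blue before its turn.\<close>

lemma source_in:
  assumes "i \<in> {1..p}"
  shows "source i \<in> e (i - 1)"
proof (rule ccontr)
  assume "source i \<notin> e (i - 1)"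
  then have "source i \<in> t i - e (i - 1)"
    using singletons(1)[OF assms] by auto
  then have "source i = target i"
    unfolding singletons(2)[OF assms] by simp
  then have "t i - e i = t i - e (i - 1)"
    using singletons[OF assms] by simp
  then have "e i = e (i - 1)"
    using e_subset[OF assms] by (metis double_diff order_refl)
  then show False using bspec[OF k_path_cliques[OF k_path] assms] by simp
qed

lemma t_eq: "i \<in> {1..p} \<Longrightarrow> t i = insert (target i) (e (i - 1))"
  using singletons(2)[of i] e_subset(2)[of i] by (metis Diff_partition Un_insert_right sup_bot_right)

lemma target_fresh: "i \<in> {1..p} \<Longrightarrow> target i \<notin> e 0 \<union> (\<Union>j\<in>{1..<i}. t j)"
  using bspec[OF k_path_fresh[OF k_path], of i] singletons(2)[of i] by auto

lemma blue_after_forces: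
  assumes "i \<le> p"
  shows "blue_after (e 0) (forces i) = e 0 \<union> (\<Union>j\<in>{1..i}. t j)"
  using assms
proof (induction i)
  case (Suc i)
  have "t (Suc i) = insert (target (Suc i)) (e i)"
    using t_eq[of "Suc i"] Suc.prems by simp
  moreover have "e i \<subseteq> e 0 \<union> (\<Union>j\<in>{1..i}. t j)"
    using e_subset(1)[of i] Suc.prems by (cases "i = 0") auto
  ultimately show ?case
    using Suc by (auto simp: forces_def blue_after_def atLeastAtMostSuc_conv)
qed (simp add: forces_def)

lemma e0_subset_pverts: "e 0 \<subseteq> pverts G"
proof -
  have "1 \<in> {1..p}" using k_path_pos[OF k_path] by simp
  then show ?thesis using e_subset(2)[of 1] k_path_verts[OF k_path] by auto
qed

lemma blue_after_all_forces: "blue_after (e 0) (forces p) = pverts G"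
  using blue_after_forces[of p] e0_subset_pverts k_path_verts[OF k_path] by auto

text \<open>A vertex of \<open>e (Suc j)\<close> comes from \<open>e j\<close> or is the fresh
  \<open>target (Suc j)\<close>. Once \<open>source i\<close> has left, it cannot return, since it
  already belongs to \<open>t i\<close> and is not fresh.\<close>

lemma source_gone:
  assumes "1 \<le> i" "i \<le> j" "j \<le> p"
  shows "source i \<notin> e j"
  using assms(2,3)
proof (induction j rule: dec_induct)
  case base
  then show ?case using singletons(1)[of i] assms(1) by auto
next
  case (step j)
  have "source i \<in> t i" using singletons(1)[of i] assms(1) step by auto
  then have "source i \<noteq> target (Suc j)"
    using target_fresh[of "Suc j"] assms(1) step by auto
  then show ?case
    using step t_eq[of "Suc j"] e_subset(1)[of "Suc j"] by auto
qed

text \<open>All cliques containing the source have index at most \<open>Suc i\<close>; those up to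
  \<open>i\<close> are blue, and \<open>t (Suc i)\<close> has the target as its only white
  vertex.\<close>

lemma can_force_source:
  assumes "i < p"
  shows "can_force G (blue_after (e 0) (forces i)) (source (Suc i)) (target (Suc i))"
proof -
  let ?C = "e 0 \<union> (\<Union>j\<in>{1..i}. t j)"
  let ?b = "source (Suc i)" and ?w = "target (Suc i)"
  have I: "Suc i \<in> {1..p}" using assms by simp
  have C: "blue_after (e 0) (forces i) = ?C"
    using blue_after_forces assms by simp
  have b: "?b \<in> e i" "?b \<in> t (Suc i)"
    using source_in[OF I] singletons(1)[OF I] by auto
  have ei: "e i \<subseteq> ?C"
    using e_subset(1)[of i] assms by (cases "i = 0") auto
  have w: "?w \<notin> ?C"
    using target_fresh[OF I] by (simp add: atLeastLessThanSuc_atLeastAtMost)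
  have wt: "?w \<in> t (Suc i)" "?w \<in> pverts G"
    using t_eq[OF I] k_path_verts[OF k_path] I by auto
  have nbr: "y = ?w" if y: "y \<notin> ?C" "(?b, y) \<in> parcs G" for y
  proof -
    obtain j where j: "j \<in> {1..p}" "?b \<in> t j" "y \<in> t j" "y \<noteq> ?b"
      using y(2) k_path_arcs[OF k_path] by auto
    \<comment> \<open>A later clique consists of \<open>e (j - 1)\<close>, which the source has left
      for good, and of a vertex fresh at stage \<open>j\<close>.\<close>
    have "j \<le> Suc i"
    proof (rule ccontr)
      assume "\<not> j \<le> Suc i"
      then have "?b \<notin> e (j - 1)" "?b \<noteq> target j"
        using source_gone[of "Suc i" "j - 1"] target_fresh[OF j(1)] j(1) b by auto
      then show False using t_eq[OF j(1)] j(2) by simp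
    qed
    moreover have "\<not> j \<le> i" using y(1) j by auto
    ultimately have "j = Suc i" by simp
    then show ?thesis using t_eq[OF I] j(3) ei y(1) by auto
  qed
  have bC: "?b \<in> ?C" using b(1) ei by blast
  have arc: "(?b, ?w) \<in> parcs G"
    unfolding k_path_arcs[OF k_path]
  proof
    show "?b \<noteq> ?w" using bC w by metis
    show "\<exists>j\<in>{1..p}. ?b \<in> t j \<and> ?w \<in> t j"
      using I b(2) wt(1) by (intro bexI[of _ "Suc i"] conjI)
  qed
  have "{x \<in> pverts G - ?C. (?b, x) \<in> parcs G} = {?w}"
  proof (intro equalityI subsetI)
    show "y \<in> {?w}" if "y \<in> {x \<in> pverts G - ?C. (?b, x) \<in> parcs G}" for y
      using nbr[of y] that by simp
    show "y \<in> {x \<in> pverts G - ?C. (?b, x) \<in> parcs G}" if "y \<in> {?w}" for y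
      using w wt(2) arc that by simp
  qed
  then show ?thesis
    unfolding can_force_def C using bC by simp
qed

lemma valid_forces_forces: "i \<le> p \<Longrightarrow> valid_forces G (e 0) (forces i)"
proof (induction i)
  case (Suc i)
  have "forces (Suc i) = forces i @ [(source (Suc i), target (Suc i))]"
    by (simp add: forces_def)
  then show ?case
    using Suc can_force_source[of i] by (simp add: valid_forces_append)
qed (simp add: forces_def)

lemma produces_zero_forcing_chains_forces:
  "produces_zero_forcing_chains G (e 0) (forces p)"
  using valid_forces_chains[OF valid_forces_forces[of p]] valid_forces_forces[of p]
    blue_after_all_forces
  by (simp add: produces_zero_forcing_chains_def)

lemma zero_forcing_set_e0: "zero_forcing_set G (e 0)"
  using valid_forces_forces[of p] blue_after_all_forces
  e0_subset_pverts by (auto simp: zero_forcing_set_def)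

text \<open>Each stage adds exactly one vertex to the \<open>k\<close> vertices of
  \<open>e 0\<close>. This count turns the rank bound \<open>p\<close> into nullity at least
  \<open>k\<close>.\<close>

lemma card_pverts: "card (pverts G) = k + p"
proof -
  have "card (e 0 \<union> (\<Union>j\<in>{1..i}. t j)) = k + i" if "i \<le> p" for i
    using that
  proof (induction i)
    case (Suc i)
    have I: "Suc i \<in> {1..p}" using Suc.prems by simp
    have "e i \<subseteq> e 0 \<union> (\<Union>j\<in>{1..i}. t j)"
      using e_subset(1)[of i] Suc.prems by (cases "i = 0") auto
    then have "e 0 \<union> (\<Union>j\<in>{1..Suc i}. t j) = insert (target (Suc i)) (e 0 \<union> (\<Union>j\<in>{1..i}. t j))"
      using t_eq[OF I] by (auto simp: atLeastAtMostSuc_conv)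
    moreover have "target (Suc i) \<notin> e 0 \<union> (\<Union>j\<in>{1..i}. t j)"
      using target_fresh[OF I] by (simp add: atLeastLessThanSuc_atLeastAtMost)
    moreover have "finite (e 0 \<union> (\<Union>j\<in>{1..i}. t j))"
      using finite_subset[OF e_subset(2)[of 1] finite_t[of 1]] finite_t Suc.prems by simp
    ultimately show ?case using Suc by simp
  qed (simp add: card_e0)
  from this[of p] show ?thesis
    using blue_after_forces[of p] blue_after_all_forces by simp
qed

end

text \<open>The witness is the sum of the all-ones matrices on the cliques: \<open>p\<close> terms
  of rank one on \<open>k + p\<close> vertices.\<close>

lemma k_path_clique_matrix:
  fixes e t :: "nat \<Rightarrow> ('v::finite) set"
  assumes "k_path k e t p G" "pverts G = UNIV"
  obtains A where "A \<in> sym_matrices G" "k \<le> nullity A"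
proof
  let ?u = "\<lambda>i. (\<chi> x. indicator (t i) x) :: real ^ 'v"
  let ?A = "\<chi> x y. \<Sum>i\<in>{1..p}. ?u i $ x * ?u i $ y"
  \<comment> \<open>The entry counts the cliques containing both \<open>x\<close> and
    \<open>y\<close>; nonnegative summands cannot cancel.\<close>
  have entries: "?A $ x $ y \<noteq> 0 \<longleftrightarrow> (\<exists>i\<in>{1..p}. x \<in> t i \<and> y \<in> t i)" for x y
    by (auto simp: sum_nonneg_eq_0_iff indicator_def)
  have sym: "transpose (\<chi> x y. \<Sum>i\<in>I. v i $ x * v i $ y) = (\<chi> x y. \<Sum>i\<in>I. v i $ x * v i $ y)"
    for v :: "nat \<Rightarrow> real ^ 'v" and I
    by (simp add: transpose_def mult.commute)
  show "?A \<in> sym_matrices G"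
    unfolding sym_matrices_def mem_Collect_eq entries k_path_arcs[OF assms(1)] sym by simp
  show "k \<le> nullity ?A"
    using nullity_sum_outer_ge[of "{1..p}" ?u] k_path_sequence.card_pverts[of k e t p G] assms
    by (simp add: k_path_sequence_def)
qed

theorem mainTheorem3:
  fixes k p :: nat and e t :: "nat \<Rightarrow> ('v::finite) set" and G :: "'v pair_pre_digraph"
  assumes "k \<ge> 1"
    and "k_path k e t p G"
    and "pverts G = UNIV"
  shows "zero_forcing_set G (e 0) \<and>
    (\<exists>b w. (\<forall>i\<in>{1..p}. t i - e i = {b i} \<and> t i - e (i - 1) = {w i}) \<and>
      produces_zero_forcing_chains G (e 0) (map (\<lambda>i. (b i, w i)) [1..<p + 1])) \<and>
    zero_forcing_number G = k \<and> max_nullity G = k"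
proof -
  interpret k_path_sequence k e t p G by unfold_locales (rule assms(2))
  obtain A where A: "A \<in> sym_matrices G" "k \<le> nullity A"
    using k_path_clique_matrix assms(2,3) by blast
  \<comment> \<open>The zero forcing set \<open>e 0\<close> bounds every nullity by
    \<open>k\<close>.\<close>
  have upper: "nullity C \<le> k" if "C \<in> sym_matrices G" for C
    using nullity_le_zero_forcing[OF that assms(3) zero_forcing_set_e0] card_e0 by simp
  have "zero_forcing_number G = card (e 0)"
  proof (rule zero_forcing_number_eqI[OF zero_forcing_set_e0])
    \<comment> \<open>The same inequality read the other way: the nullity of the single matrix
      \<open>A\<close> bounds all zero forcing sets from below.\<close>
    show "card (e 0) \<le> card B" if "zero_forcing_set G B" for B
      using nullity_le_zero_forcing[OF A(1) assms(3) that] A(2) card_e0 by simp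
  qed
  moreover have "max_nullity G = nullity A"
    using A upper by (intro max_nullity_eqI) (auto intro: order.trans)
  moreover have "nullity A = k" using A upper by (simp add: order.antisym)
  \<comment> \<open>The witnesses are \<open>source\<close> and \<open>target\<close>.\<close>
  moreover have "\<exists>b w. (\<forall>i\<in>{1..p}. t i - e i = {b i} \<and> t i - e (i - 1) = {w i}) \<and>
      produces_zero_forcing_chains G (e 0) (map (\<lambda>i. (b i, w i)) [1..<p + 1])"
    using singletons produces_zero_forcing_chains_forces unfolding forces_def by blast
  ultimately show ?thesis using zero_forcing_set_e0 card_e0 by simp
qed

end
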